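(* Let $\mu$ be a finite positive Borel measure on $\mathbb{R}$. Suppose that $\mu$ has a weak-singularity of type $\varrho\in[0,1)$. Then there exists a constant $C_\mu>0$ such that: (i) if $0\le\varrho<\frac12$, then $\displaystyle\frac1t\int_0^t\Big|\int_{\mathbb{R}}e^{-2\pi isx}\,d\mu(x)\Big|^2ds\le C_\mu\,\frac1t$ for all $t>0$; (ii) if $\varrho=\frac12$, then $\displaystyle\frac1t\int_0^t\Big|\int_{\mathbb{R}}e^{-2\pi isx}\,d\mu(x)\Big|^2ds\le C_\mu\,\frac{\log(t)}{t}$ for all $t>2$; (iii) if $\frac12<\varrho<1$, then $\displaystyle\frac1t\int_0^t\Big|\int_{\mathbb{R}}e^{-2\pi isx}\,d\mu(x)\Big|^2ds\le C_\mu\,\frac{1}{t^{2(1-\varrho)}}$ for all $t>0$.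
   Context: Singularity of type $\varrho$: a positive Borel measure $\nu$ on $\mathbb{R}$, absolutely continuous with respect to Lebesgue measure with Radon–Nikodym derivative $f$, has a singularity of type $\varrho\in[0,1)$ if there exist a constant $\gamma>0$, finitely many disjoint bounded intervals $[a_j,a_{j+1})$, points $b_j\in[a_j,a_{j+1})$ and numbers $0\le\varrho_j\le\varrho$, $j=1,\dots,n$, such that $f(x)=\sum_{j=1}^nf_j(x)$, $x\in\mathbb{R}$, where for each $j$ $$f_j(x)\le\gamma\,\frac{\chi_{[a_j,a_{j+1})}(x)}{|x-b_j|^{\varrho_j}},\qquad x\in\mathbb{R}.$$ Weak-singularity of type $\varrho$: a positive Borel measure $\mu$ on $\mathbb{R}$ has a weak-singularity of type $\varrho$ if there exist a measure $\nu$ having a singularity of type $\varrho$ and a constant $\gamma'>0$ such that for every continuous non-negative real-valued function $f$, $\int_{\mathbb{R}}f\,d\mu\le\gamma'\int_{\mathbb{R}}f\,d\nu$. *)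

theory Defs
  imports "HOL-Probability.Probability"
begin

text \<open>
  The power \<open>\<bar>y\<bar>\<^sup>r\<close> for \<open>r \<ge> 0\<close>, with the usual convention \<open>0\<^sup>0 = 1\<close>
  (whereas \<open>0 powr 0 = 0\<close> in HOL).
\<close>
definition abs_pow :: "real \<Rightarrow> real \<Rightarrow> real" where
  "abs_pow y r = (if r = 0 then 1 else \<bar>y\<bar> powr r)"

text \<open>
  The bound on \<open>F j\<close> is stated in the extended reals, where \<open>c / 0 = \<infinity>\<close> for \<open>c > 0\<close>; hence it is
  void at \<open>x = b j\<close> when \<open>\<rho> j > 0\<close>. As in the informal definition, the \<open>F j\<close> are
  only bounded from above; non-negativity is required of their sum, the density \<open>f\<close>.
  That the density has a real-valued version is no restriction, as the bound makes it
  finite away from the points \<open>b j\<close>.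
\<close>
definition has_singularity :: "real measure \<Rightarrow> real \<Rightarrow> bool" where
  "has_singularity \<nu> \<rho>0 \<longleftrightarrow>
     0 \<le> \<rho>0 \<and> \<rho>0 < 1 \<and>
     (\<exists>f :: real \<Rightarrow> real.
        f \<in> borel_measurable borel \<and> (\<forall>x. 0 \<le> f x) \<and>
        \<nu> = density lborel (\<lambda>x. ennreal (f x)) \<and>
        (\<exists>(\<gamma>::real) (n::nat) (a :: nat \<Rightarrow> real) (b :: nat \<Rightarrow> real) (\<rho> :: nat \<Rightarrow> real)
            (F :: nat \<Rightarrow> real \<Rightarrow> real).
           0 < \<gamma> \<and>
           disjoint_family_on (\<lambda>j. {a j..<a (j + 1)}) {1..n} \<and>
           (\<forall>j\<in>{1..n}. b j \<in> {a j..<a (j + 1)} \<and> 0 \<le> \<rho> j \<and> \<rho> j \<le> \<rho>0) \<and>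
           (\<forall>x. f x = (\<Sum>j=1..n. F j x)) \<and>
           (\<forall>j\<in>{1..n}. \<forall>x. ereal (F j x) \<le>
              ereal \<gamma> * (indicator {a j..<a (j + 1)} x / ereal (abs_pow (x - b j) (\<rho> j))))))"

text \<open>
  The integrals of the non-negative test functions take values in \<open>[0, \<infinity>]\<close>.
\<close>
definition has_weak_singularity :: "real measure \<Rightarrow> real \<Rightarrow> bool" where
  "has_weak_singularity \<mu> \<rho> \<longleftrightarrow>
     (\<exists>\<nu> \<gamma>. has_singularity \<nu> \<rho> \<and> (0::real) < \<gamma> \<and>
        (\<forall>f :: real \<Rightarrow> real. continuous_on UNIV f \<longrightarrow> (\<forall>x. 0 \<le> f x) \<longrightarrow>
           (\<integral>\<^sup>+x. ennreal (f x) \<partial>\<mu>) \<le> ennreal \<gamma> * (\<integral>\<^sup>+x. ennreal (f x) \<partial>\<nu>)))"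

definition fourier_transform :: "real measure \<Rightarrow> real \<Rightarrow> complex" where
  "fourier_transform \<mu> s = (CLINT x|\<mu>. exp (- 2 * pi * \<i> * complex_of_real s * complex_of_real x))"

end

theory Submission
  imports Defs
begin

text \<open>
  The mean of \<open>\<bar>fourier_transform \<mu>\<bar>\<^sup>2\<close> over \<open>[0, t]\<close> is at most a constant times its mean against a Gaussian weight of
  width \<open>t\<close>, and by Fubini the latter is the energy \<open>\<integral>\<integral> g (x - y) d\<mu> d\<mu>\<close> of a Gaussian kernel \<open>g \<le> 1\<close> of
  integral \<open>O(1/t)\<close>. As \<open>g\<close> is continuous, both copies of \<open>\<mu>\<close> may be replaced by the dominating
  density, a multiple of \<open>\<Sum>j. \<bar>x - b j\<bar> powr -\<rho>\<close> on a bounded set. Cut this density at distance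
  \<open>\<delta>\<close> from the points \<open>b j\<close> into a far part \<open>u\<close> and a near part \<open>v\<close>. Then the far-far energy is
  at most \<open>\<integral>g * \<integral>u\<^sup>2\<close> by AM-GM, the cross energy at most \<open>\<integral>g * sup u * \<integral>v\<close>, and the near-near
  energy at most \<open>(\<integral>v)\<^sup>2\<close>. For \<open>\<rho> < 1/2\<close> the density is square integrable and \<open>\<delta> = 0\<close> works;
  otherwise \<open>\<delta> = 1/t\<close> balances the three terms.
\<close>

section \<open>The Gaussian kernel\<close>

text \<open>The characteristic function of a centred normal law of standard deviation
  \<open>c\<close>, hence normalised by its value 1 at the origin; its mass is of order
  \<open>1 / c\<close>.\<close>

definition gauss :: "real \<Rightarrow> real \<Rightarrow> real" where
  "gauss c z = exp (- (c * z)\<^sup>2 / 2)"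

lemma gauss_nonneg [simp]: "0 \<le> gauss c z" and gauss_le_1: "gauss c z \<le> 1"
  by (auto simp: gauss_def)

lemma gauss_commute: "gauss c (x - y) = gauss c (y - x)"
  by (simp add: gauss_def power2_eq_square algebra_simps)

lemma continuous_on_gauss [continuous_intros]:
  "continuous_on S f \<Longrightarrow> continuous_on S (\<lambda>x. gauss c (f x))"
  unfolding gauss_def by (auto intro!: continuous_intros)

lemma borel_measurable_gauss [measurable]: "gauss c \<in> borel_measurable borel"
  unfolding gauss_def by measurable

text \<open>As a function of \<open>z\<close> the kernel is a multiple of the normal density with
  mean \<open>y\<close> and standard deviation \<open>1 / c\<close>.\<close>

lemma nn_integral_gauss:
  assumes "0 < c"
  shows "(\<integral>\<^sup>+z. gauss c (y - z) \<partial>lborel) = ennreal (sqrt (2 * pi) / c)"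
proof -
  have eq: "gauss c (y - z) = sqrt (2 * pi) / c * normal_density y (1 / c) z" for z
    using assms by (simp add: gauss_def normal_density_def real_sqrt_mult real_sqrt_divide field_simps
        power2_eq_square)
  have "(\<integral>\<^sup>+z. gauss c (y - z) \<partial>lborel)
      = ennreal (\<integral>z. sqrt (2 * pi) / c * normal_density y (1 / c) z \<partial>lborel)"
    unfolding eq using assms by (intro nn_integral_eq_integral) (auto simp: normal_density_nonneg)
  also have "\<dots> = ennreal (sqrt (2 * pi) / c)"
    using assms by simp
  finally show ?thesis .
qed

lemma char_std_normal_gauss: "(\<integral>u. iexp (c * u * z) \<partial>std_normal_distribution) = complex_of_real (gauss c z)"
  using fun_cong[OF char_std_normal_distribution, of "c * z"]
  by (simp add: char_def gauss_def mult_ac)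

section \<open>Gaussian means of the squared characteristic function\<close>

context finite_borel_measure
begin

lemma measurable_cong_borel [measurable_cong]: "sets M = sets borel"
  by (rule M_is_borel)

lemma norm_char_le: "cmod (char M a) \<le> measure M (space M)"
proof -
  have "norm (char M a) \<le> (\<integral>x. norm (iexp (a * x)) \<partial>M)"
    unfolding char_def by (rule integral_norm_bound)
  then show ?thesis by (simp del: of_real_mult)
qed

lemma borel_measurable_char [measurable]: "char M \<in> borel_measurable borel"
proof -
  have "(\<lambda>a. char M a) \<in> borel_measurable borel"
    unfolding char_def by (rule borel_measurable_lebesgue_integral) measurable
  then show ?thesis by simp
qed

text \<open>The squared modulus is \<open>char M a\<close> times its conjugate, and Fubini merges
  the two integrals into one over the product measure.\<close>

lemma norm_char_squared:
  "complex_of_real ((cmod (char M a))\<^sup>2) = (\<integral>p. iexp (a * (fst p - snd p)) \<partial>(M \<Otimes>\<^sub>M M))"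
proof -
  interpret pair_sigma_finite M M ..
  interpret P: finite_measure "M \<Otimes>\<^sub>M M"
    by (rule finite_measure_pair_measure) unfold_locales
  have int: "integrable (M \<Otimes>\<^sub>M M) (\<lambda>(x, y). iexp (a * (x - y)))"
    by (rule P.integrable_const_bound[where B = 1]) (auto simp del: of_real_mult of_real_diff simp: split_beta)
  have "(\<integral>p. iexp (a * (fst p - snd p)) \<partial>(M \<Otimes>\<^sub>M M)) = (\<integral>x. \<integral>y. iexp (a * (x - y)) \<partial>M \<partial>M)"
    using integral_fst'[OF int] by (simp add: case_prod_beta')
  also have "\<dots> = (\<integral>x. \<integral>y. iexp (a * x) * cnj (iexp (a * y)) \<partial>M \<partial>M)"
    by (simp add: exp_cnj exp_diff exp_minus field_simps flip: exp_add)
  also have "\<dots> = char M a * cnj (char M a)"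
    by (simp add: char_def)
  finally show ?thesis
    by (simp only: complex_norm_square)
qed

text \<open>After \<open>norm_char_squared\<close> and a swap of integrals, the inner integral over
  \<open>u\<close> is the characteristic function of the normal law at \<open>c * (x - y)\<close>,
  that is, the kernel.\<close>

lemma gaussian_mean_norm_char_squared:
  "ennreal (\<integral>u. (cmod (char M (c * u)))\<^sup>2 \<partial>std_normal_distribution)
    = (\<integral>\<^sup>+x. \<integral>\<^sup>+y. gauss c (x - y) \<partial>M \<partial>M)"
proof -
  interpret MM: pair_sigma_finite M M ..
  interpret P: finite_measure "M \<Otimes>\<^sub>M M"
    by (rule finite_measure_pair_measure) unfold_locales
  interpret N: prob_space std_normal_distribution
    by (rule prob_space_normal_density) simp
  interpret NP: pair_sigma_finite std_normal_distribution "M \<Otimes>\<^sub>M M" ..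
  interpret NPf: finite_measure "std_normal_distribution \<Otimes>\<^sub>M (M \<Otimes>\<^sub>M M)"
    by (rule finite_measure_pair_measure) unfold_locales
  \<comment> \<open>The integrand has modulus 1 and the product measure is finite.\<close>
  have int: "integrable (std_normal_distribution \<Otimes>\<^sub>M (M \<Otimes>\<^sub>M M)) (\<lambda>(u, p). iexp (c * u * (fst p - snd p)))"
    by (rule NPf.integrable_const_bound[where B = 1])
       (auto simp del: of_real_mult of_real_diff simp: split_beta)
  have "complex_of_real (\<integral>u. (cmod (char M (c * u)))\<^sup>2 \<partial>std_normal_distribution)
      = (\<integral>u. \<integral>p. iexp (c * u * (fst p - snd p)) \<partial>(M \<Otimes>\<^sub>M M) \<partial>std_normal_distribution)"
    by (simp only: norm_char_squared flip: integral_complex_of_real)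
  also have "\<dots> = (\<integral>p. \<integral>u. iexp (c * u * (fst p - snd p)) \<partial>std_normal_distribution \<partial>(M \<Otimes>\<^sub>M M))"
    by (rule NP.Fubini_integral[symmetric]) (use int in simp)
  also have "\<dots> = complex_of_real (\<integral>p. gauss c (fst p - snd p) \<partial>(M \<Otimes>\<^sub>M M))"
    by (simp only: char_std_normal_gauss integral_complex_of_real)
  finally have "(\<integral>u. (cmod (char M (c * u)))\<^sup>2 \<partial>std_normal_distribution)
      = (\<integral>p. gauss c (fst p - snd p) \<partial>(M \<Otimes>\<^sub>M M))"
    using of_real_eq_iff by blast
  also have "ennreal \<dots> = (\<integral>\<^sup>+p. gauss c (fst p - snd p) \<partial>(M \<Otimes>\<^sub>M M))"
    by (rule nn_integral_eq_integral[symmetric], rule P.integrable_const_bound[where B = 1])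
       (auto simp: gauss_le_1)
  also have "\<dots> = (\<integral>\<^sup>+x. \<integral>\<^sup>+y. gauss c (x - y) \<partial>M \<partial>M)"
    by (subst nn_integral_fst[symmetric]) auto
  finally show ?thesis .
qed

text \<open>Substituting \<open>s = t * u\<close> turns the mean over \<open>[0, t]\<close> into an
  integral over \<open>[0, 1]\<close>, where the standard normal density is at least
  \<open>exp (- 1 / 2) / sqrt (2 * pi)\<close>; this gives the constant. The frequency
  \<open>2 * pi * s\<close> becomes \<open>(2 * pi * t) * u\<close>, which gives the parameter of
  the kernel.\<close>

lemma mean_norm_fourier_transform_squared_le:
  assumes "0 < t"
  shows "ennreal (1 / t * (LBINT s:{0..t}. (cmod (fourier_transform M s))\<^sup>2))
    \<le> ennreal (sqrt (2 * pi) * exp (1 / 2)) * (\<integral>\<^sup>+x. \<integral>\<^sup>+y. gauss (2 * pi * t) (x - y) \<partial>M \<partial>M)"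
proof -
  define h where "h u = (cmod (char M ((2 * pi * t) * u)))\<^sup>2" for u
  \<comment> \<open>The exponents have opposite signs, so the two transforms are conjugate and have
    equal modulus.\<close>
  have ft: "fourier_transform M s = cnj (char M (2 * pi * s))" for s
    unfolding fourier_transform_def char_def
    by (subst Bochner_Integration.integral_cnj[symmetric]) (simp add: exp_cnj mult_ac)
  have [measurable]: "h \<in> borel_measurable borel"
    unfolding h_def by measurable
  interpret N: prob_space std_normal_distribution
    by (rule prob_space_normal_density) simp
  have "integrable std_normal_distribution h"
    by (rule N.integrable_const_bound[where B = "(measure M (space M))\<^sup>2"])
       (auto simp: h_def intro!: power_mono norm_char_le)
  then have int: "integrable lborel (\<lambda>u. std_normal_density u * h u)"
    by (subst (asm) integrable_density) (auto simp: normal_density_nonneg)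
  have "(LBINT s:{0..t}. (cmod (fourier_transform M s))\<^sup>2)
      = (\<integral>s. indicator {0..t} s * (cmod (char M (2 * pi * s)))\<^sup>2 \<partial>lborel)"
    by (simp add: set_lebesgue_integral_def ft)
  also have "\<dots> = t * (\<integral>u. indicator {0..t} (t * u) * h u \<partial>lborel)"
    using assms by (subst lborel_integral_real_affine[where c = t and t = 0]) (auto simp: h_def mult_ac)
  finally have "1 / t * (LBINT s:{0..t}. (cmod (fourier_transform M s))\<^sup>2)
      = (\<integral>u. indicator {0..t} (t * u) * h u \<partial>lborel)"
    using assms by simp
  also have "\<dots> \<le> (\<integral>u. (sqrt (2 * pi) * exp (1 / 2)) * (std_normal_density u * h u) \<partial>lborel)"
  proof (rule integral_mono')
    fix u :: real
    show "indicator {0..t} (t * u) * h u \<le> sqrt (2 * pi) * exp (1 / 2) * (std_normal_density u * h u)"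
    proof (cases "0 \<le> u \<and> u \<le> 1")
      case True
      then have "u\<^sup>2 \<le> 1" by (simp add: power_le_one)
      then have "1 \<le> sqrt (2 * pi) * exp (1 / 2) * std_normal_density u"
        by (simp add: std_normal_density_def flip: exp_add)
      then have "1 * h u \<le> sqrt (2 * pi) * exp (1 / 2) * std_normal_density u * h u"
        by (intro mult_right_mono) (auto simp: h_def)
      then show ?thesis using True assms by (auto simp: indicator_def h_def mult_ac)
    next
      case False
      then have "indicator {0..t} (t * u) = (0::real)"
        using assms by (auto simp: indicator_def zero_le_mult_iff mult_le_cancel_left1)
      then show ?thesis by (simp add: h_def normal_density_nonneg)
    qed
  qed (use int in \<open>auto simp: h_def normal_density_nonneg\<close>)
  also have "\<dots> = sqrt (2 * pi) * exp (1 / 2) * (\<integral>u. h u \<partial>std_normal_distribution)"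
    by (subst integral_density) (auto simp: normal_density_nonneg)
  finally have "ennreal (1 / t * (LBINT s:{0..t}. (cmod (fourier_transform M s))\<^sup>2))
      \<le> ennreal (sqrt (2 * pi) * exp (1 / 2)) * ennreal (\<integral>u. h u \<partial>std_normal_distribution)"
    by (simp add: ennreal_leI flip: ennreal_mult')
  then show ?thesis
    by (simp only: h_def gaussian_mean_norm_char_squared)
qed

end

section \<open>Energy estimates for the Gaussian kernel\<close>

text \<open>Domination is known only for continuous non-negative integrands. The kernel is one in
  each variable separately, so the hypothesis applies once per variable, each time at the cost of a
  factor \<open>\<kappa>\<close>.\<close>

lemma (in finite_borel_measure) gauss_energy_le_of_dominated:
  fixes G :: "real \<Rightarrow> ennreal"
  assumes [measurable]: "G \<in> borel_measurable borel"
    and dom: "\<And>f :: real \<Rightarrow> real. continuous_on UNIV f \<Longrightarrow> (\<And>x. 0 \<le> f x) \<Longrightarrow>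
      (\<integral>\<^sup>+x. ennreal (f x) \<partial>M) \<le> \<kappa> * (\<integral>\<^sup>+x. ennreal (f x) * G x \<partial>lborel)"
  shows "(\<integral>\<^sup>+x. \<integral>\<^sup>+y. gauss c (x - y) \<partial>M \<partial>M)
    \<le> \<kappa>\<^sup>2 * (\<integral>\<^sup>+x. \<integral>\<^sup>+y. gauss c (x - y) * (G x * G y) \<partial>lborel \<partial>lborel)"
proof -
  interpret P: pair_sigma_finite M lborel ..
  have "(\<integral>\<^sup>+x. \<integral>\<^sup>+y. gauss c (x - y) \<partial>M \<partial>M)
      \<le> (\<integral>\<^sup>+x. \<kappa> * (\<integral>\<^sup>+y. gauss c (x - y) * G y \<partial>lborel) \<partial>M)"
    by (intro nn_integral_mono dom) (auto intro!: continuous_intros)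
  also have "\<dots> = \<kappa> * (\<integral>\<^sup>+x. \<integral>\<^sup>+y. gauss c (x - y) * G y \<partial>lborel \<partial>M)"
    by (rule nn_integral_cmult) measurable
  \<comment> \<open>The swap puts the remaining integral over \<open>M\<close> inside, where
    domination applies to it for fixed \<open>y\<close>.\<close>
  also have "(\<integral>\<^sup>+x. \<integral>\<^sup>+y. gauss c (x - y) * G y \<partial>lborel \<partial>M)
      = (\<integral>\<^sup>+y. \<integral>\<^sup>+x. gauss c (x - y) * G y \<partial>M \<partial>lborel)"
    by (rule P.Fubini'[symmetric]) measurable
  also have "\<dots> = (\<integral>\<^sup>+y. (\<integral>\<^sup>+x. gauss c (x - y) \<partial>M) * G y \<partial>lborel)"
    by (intro nn_integral_cong nn_integral_multc) measurable
  also have "\<dots> \<le> (\<integral>\<^sup>+y. \<kappa> * (\<integral>\<^sup>+x. gauss c (x - y) * G x \<partial>lborel) * G y \<partial>lborel)"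
    by (intro nn_integral_mono mult_right_mono dom) (auto intro!: continuous_intros)
  also have "\<dots> = \<kappa> * (\<integral>\<^sup>+y. (\<integral>\<^sup>+x. gauss c (x - y) * G x \<partial>lborel) * G y \<partial>lborel)"
    by (subst nn_integral_cmult[symmetric]) (auto simp: mult_ac)
  also have "(\<integral>\<^sup>+y. (\<integral>\<^sup>+x. gauss c (x - y) * G x \<partial>lborel) * G y \<partial>lborel)
      = (\<integral>\<^sup>+x. \<integral>\<^sup>+y. gauss c (x - y) * (G x * G y) \<partial>lborel \<partial>lborel)"
    by (subst nn_integral_multc[symmetric]) (auto simp: mult_ac gauss_commute)
  finally show ?thesis
    by (simp add: mult_left_mono power2_eq_square mult.assoc)
qed

text \<open>The bound \<open>m\<close> is extended real, so that \<open>u\<close> may be unbounded: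
  with \<open>m = \<top>\<close> the estimate still has content when the integral of
  \<open>v\<close> vanishes.\<close>

lemma gauss_energy_le:
  fixes u v :: "real \<Rightarrow> real" and m :: ennreal
  assumes "0 < c"
    and [measurable]: "u \<in> borel_measurable borel" "v \<in> borel_measurable borel"
    and nonneg: "\<And>x. 0 \<le> u x" "\<And>x. 0 \<le> v x"
    and m: "\<And>x. ennreal (u x) \<le> m"
  defines "A \<equiv> ennreal (sqrt (2 * pi) / c)"
  shows "(\<integral>\<^sup>+x. \<integral>\<^sup>+y. ennreal (gauss c (x - y)) * (ennreal (u x + v x) * ennreal (u y + v y)) \<partial>lborel \<partial>lborel)
    \<le> A * ((\<integral>\<^sup>+x. ennreal ((u x)\<^sup>2) \<partial>lborel) + 2 * m * (\<integral>\<^sup>+x. v x \<partial>lborel)) + (\<integral>\<^sup>+x. v x \<partial>lborel)\<^sup>2"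
    (is "?E \<le> A * (?F + 2 * m * ?N) + ?N\<^sup>2")
proof -
  have kernel: "(\<integral>\<^sup>+y. ennreal (gauss c (x - y)) \<partial>lborel) = A" for x
    unfolding A_def by (rule nn_integral_gauss[OF assms(1)])
  \<comment> \<open>When the weight depends on one variable only, integrating out the other yields
    the mass \<open>A\<close> of the kernel.\<close>
  have right: "(\<integral>\<^sup>+x. \<integral>\<^sup>+y. ennreal (gauss c (x - y)) * w x \<partial>lborel \<partial>lborel) = A * (\<integral>\<^sup>+x. w x \<partial>lborel)"
    if [measurable]: "w \<in> borel_measurable borel" for w
    by (simp add: nn_integral_multc nn_integral_cmult kernel)
  have left: "(\<integral>\<^sup>+x. \<integral>\<^sup>+y. ennreal (gauss c (x - y)) * w y \<partial>lborel \<partial>lborel) = A * (\<integral>\<^sup>+x. w x \<partial>lborel)"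
    if [measurable]: "w \<in> borel_measurable borel" for w
    by (subst lborel_pair.Fubini') (auto simp: gauss_commute right)
  have "?E \<le> (\<integral>\<^sup>+x. \<integral>\<^sup>+y. ennreal (gauss c (x - y)) * ennreal ((u x)\<^sup>2 / 2)
      + ennreal (gauss c (x - y)) * ennreal ((u y)\<^sup>2 / 2)
      + ennreal (gauss c (x - y)) * (m * v y) + ennreal (gauss c (x - y)) * (m * v x)
      + ennreal (v x) * ennreal (v y) \<partial>lborel \<partial>lborel)"
  proof (intro nn_integral_mono)
    fix x y
    let ?k = "gauss c (x - y)"
    have amgm: "u x * u y \<le> (u x)\<^sup>2 / 2 + (u y)\<^sup>2 / 2"
      using sum_squares_bound[of "u x" "u y"] by simp
    have "?k * ((u x + v x) * (u y + v y)) = ?k * (u x * u y) + ?k * (u x * v y) + ?k * (u y * v x) + ?k * (v x * v y)"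
      by (simp add: algebra_simps)
    \<comment> \<open>The kernel is kept wherever its mass is to be used; only in the product of the
      two \<open>v\<close> terms is it replaced by 1.\<close>
    also have "\<dots> \<le> ?k * ((u x)\<^sup>2 / 2 + (u y)\<^sup>2 / 2) + ?k * (u x * v y) + ?k * (u y * v x) + 1 * (v x * v y)"
      by (intro add_mono mult_mono mult_left_mono amgm order_refl gauss_le_1) (auto simp: nonneg)
    finally have "ennreal (?k * ((u x + v x) * (u y + v y)))
        \<le> ennreal (?k * ((u x)\<^sup>2 / 2) + ?k * ((u y)\<^sup>2 / 2) + ?k * (u x * v y) + ?k * (u y * v x) + v x * v y)"
      by (intro ennreal_leI) (simp add: distrib_left)
    then have "ennreal ?k * (ennreal (u x + v x) * ennreal (u y + v y)) \<le> ennreal ?k * ennreal ((u x)\<^sup>2 / 2)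
        + ennreal ?k * ennreal ((u y)\<^sup>2 / 2) + ennreal ?k * (ennreal (u x) * ennreal (v y))
        + ennreal ?k * (ennreal (u y) * ennreal (v x)) + ennreal (v x) * ennreal (v y)"
      \<comment> \<open>The products are split inside \<open>ennreal\<close> because
        \<open>m\<close>, possibly infinite, can replace \<open>u\<close> only there.\<close>
      by (simp add: nonneg flip: ennreal_mult ennreal_plus)
    also have "\<dots> \<le> ennreal ?k * ennreal ((u x)\<^sup>2 / 2)
        + ennreal ?k * ennreal ((u y)\<^sup>2 / 2) + ennreal ?k * (m * ennreal (v y))
        + ennreal ?k * (m * ennreal (v x)) + ennreal (v x) * ennreal (v y)"
      by (intro add_mono mult_left_mono mult_right_mono m order_refl) auto
    finally show "ennreal ?k * (ennreal (u x + v x) * ennreal (u y + v y)) \<le> \<dots>" .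
  qed
  also have "\<dots> = A * (\<integral>\<^sup>+x. ennreal ((u x)\<^sup>2 / 2) \<partial>lborel) + A * (\<integral>\<^sup>+x. ennreal ((u x)\<^sup>2 / 2) \<partial>lborel)
      + A * (m * ?N) + A * (m * ?N) + ?N * ?N"
    by (simp add: nn_integral_add left nn_integral_cmult nn_integral_multc kernel)
  also have "\<dots> = A * (\<integral>\<^sup>+x. ennreal ((u x)\<^sup>2 / 2) + ennreal ((u x)\<^sup>2 / 2) \<partial>lborel) + 2 * (A * (m * ?N)) + ?N\<^sup>2"
    by (simp add: nn_integral_add distrib_left mult_2 power2_eq_square add.assoc)
  also have "\<dots> = A * (?F + 2 * m * ?N) + ?N\<^sup>2"
    by (simp add: distrib_left mult_ac flip: ennreal_plus)
  finally show ?thesis .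
qed

section \<open>The power singularity cut at distance \<open>\<delta>\<close>\<close>

text \<open>With \<open>L\<close> in place of \<open>\<delta>\<close> this is also the uncut
  singularity. It vanishes at \<open>y = 0\<close>, since \<open>0 powr r = 0\<close>; the singular
  point therefore has to be removed as a null set.\<close>

definition near :: "real \<Rightarrow> real \<Rightarrow> real \<Rightarrow> real" where
  "near \<rho> \<delta> y = (if \<bar>y\<bar> \<le> \<delta> then \<bar>y\<bar> powr -\<rho> else 0)"

definition far :: "real \<Rightarrow> real \<Rightarrow> real \<Rightarrow> real \<Rightarrow> real" where
  "far \<rho> \<delta> L y = (if \<delta> < \<bar>y\<bar> \<and> \<bar>y\<bar> \<le> L then \<bar>y\<bar> powr -\<rho> else 0)"

lemma near_nonneg [simp]: "0 \<le> near \<rho> \<delta> y" and far_nonneg [simp]: "0 \<le> far \<rho> \<delta> L y"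
  by (auto simp: near_def far_def)

lemma near_abs [simp]: "near \<rho> \<delta> \<bar>y\<bar> = near \<rho> \<delta> y" and far_abs [simp]: "far \<rho> \<delta> L \<bar>y\<bar> = far \<rho> \<delta> L y"
  by (auto simp: near_def far_def)

lemma borel_measurable_near [measurable]: "near \<rho> \<delta> \<in> borel_measurable borel"
  and borel_measurable_far [measurable]: "far \<rho> \<delta> L \<in> borel_measurable borel"
  unfolding near_def far_def by measurable

text \<open>An inequality because \<open>\<delta>\<close> may exceed \<open>L\<close>, as
  \<open>\<delta> = 1 / t\<close> does for small \<open>t\<close>: then \<open>far\<close> is zero
  and \<open>near \<rho> \<delta>\<close> reaches beyond \<open>L\<close>.\<close>

lemma near_le_near_add_far: "near \<rho> L y \<le> far \<rho> \<delta> L y + near \<rho> \<delta> y"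
  by (auto simp: near_def far_def)

text \<open>The negative half-line is reflected onto the positive one. The origin is counted twice,
  so the integrands are compared by an inequality.\<close>

lemma nn_integral_abs_le:
  fixes h :: "real \<Rightarrow> ennreal"
  assumes [measurable]: "h \<in> borel_measurable borel"
  shows "(\<integral>\<^sup>+y. h \<bar>y\<bar> \<partial>lborel) \<le> 2 * (\<integral>\<^sup>+y. h y * indicator {0..} y \<partial>lborel)"
proof -
  have "(\<integral>\<^sup>+y. h \<bar>y\<bar> \<partial>lborel)
      \<le> (\<integral>\<^sup>+y. h y * indicator {0..} y + h (- y) * indicator {0..} (- y) \<partial>lborel)"
    by (intro nn_integral_mono) (auto simp: indicator_def)
  also have "\<dots> = (\<integral>\<^sup>+y. h y * indicator {0..} y \<partial>lborel) + (\<integral>\<^sup>+y. h (- y) * indicator {0..} (- y) \<partial>lborel)"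
    by (rule nn_integral_add) measurable
  also have "(\<integral>\<^sup>+y. h (- y) * indicator {0..} (- y) \<partial>lborel) = (\<integral>\<^sup>+y. h y * indicator {0..} y \<partial>lborel)"
    by (subst nn_integral_real_affine[where c = "-1" and t = 0 and f = "\<lambda>y. h y * indicator {0..} y"]) auto
  finally show ?thesis by (simp add: mult_2)
qed

text \<open>The power is integrable at 0 as \<open>\<rho> < 1\<close>. For
  \<open>\<delta> = 0\<close> the bound is 0.\<close>

lemma nn_integral_near_le:
  assumes "\<rho> < 1" "0 \<le> \<delta>"
  shows "(\<integral>\<^sup>+y. near \<rho> \<delta> y \<partial>lborel) \<le> ennreal (2 * \<delta> powr (1 - \<rho>) / (1 - \<rho>))"
proof -
  have "(\<integral>\<^sup>+y. near \<rho> \<delta> y \<partial>lborel) = (\<integral>\<^sup>+y. near \<rho> \<delta> \<bar>y\<bar> \<partial>lborel)"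
    by simp
  also have "\<dots> \<le> 2 * (\<integral>\<^sup>+y. ennreal (near \<rho> \<delta> y) * indicator {0..} y \<partial>lborel)"
    by (rule nn_integral_abs_le) measurable
  also have "(\<integral>\<^sup>+y. ennreal (near \<rho> \<delta> y) * indicator {0..} y \<partial>lborel)
      = (\<integral>\<^sup>+y. ennreal (y powr -\<rho>) * indicator {0..\<delta>} y \<partial>lborel)"
    by (intro nn_integral_cong) (auto simp: near_def indicator_def)
  also have "\<dots> = ennreal (\<delta> powr (-\<rho> + 1) / (-\<rho> + 1))"
    by (rule nn_integral_has_integral_lebesgue'[OF _ has_integral_powr_from_0]) (use assms in auto)
  also have "2 * \<dots> = ennreal (2 * \<delta> powr (1 - \<rho>) / (1 - \<rho>))"
    using assms by (simp add: ennreal_mult' ennreal_numeral[symmetric] add.commute flip: ennreal_mult' del: ennreal_numeral)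
  finally show ?thesis .
qed

text \<open>The right-hand integral is left unevaluated: its size depends on whether
  \<open>2 * \<rho>\<close> is below, equal to or above 1.\<close>

lemma nn_integral_far_squared_le:
  assumes "0 \<le> \<delta>"
  shows "(\<integral>\<^sup>+y. ennreal ((far \<rho> \<delta> L y)\<^sup>2) \<partial>lborel)
    \<le> 2 * (\<integral>\<^sup>+y. ennreal (y powr (- (2 * \<rho>))) * indicator {\<delta>..L} y \<partial>lborel)"
proof -
  have "(\<integral>\<^sup>+y. ennreal ((far \<rho> \<delta> L y)\<^sup>2) \<partial>lborel) = (\<integral>\<^sup>+y. ennreal ((far \<rho> \<delta> L \<bar>y\<bar>)\<^sup>2) \<partial>lborel)"
    by simp
  also have "\<dots> \<le> 2 * (\<integral>\<^sup>+y. ennreal ((far \<rho> \<delta> L y)\<^sup>2) * indicator {0..} y \<partial>lborel)"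
    by (rule nn_integral_abs_le) measurable
  also have "\<dots> \<le> 2 * (\<integral>\<^sup>+y. ennreal (y powr (- (2 * \<rho>))) * indicator {\<delta>..L} y \<partial>lborel)"
    by (intro mult_left_mono nn_integral_mono)
       (use assms in \<open>auto simp: far_def indicator_def power2_eq_square simp flip: powr_add\<close>)
  finally show ?thesis .
qed

section \<open>An explicit dominating density\<close>

text \<open>Every local exponent \<open>r j\<close> is raised to \<open>\<rho>\<close>, at the cost
  of a factor \<open>L\<close>, and every interval is enlarged to the ball of radius
  \<open>L\<close> about \<open>b j\<close>. The dominating density is then a sum of translates of
  one even function.\<close>

lemma has_weak_singularity_dominated:
  assumes "has_weak_singularity \<mu> \<rho>"
  obtains n :: nat and b :: "nat \<Rightarrow> real" and L \<kappa> :: real where "1 \<le> L" "0 < \<kappa>"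
    "\<forall>f :: real \<Rightarrow> real. continuous_on UNIV f \<longrightarrow> (\<forall>x. 0 \<le> f x) \<longrightarrow>
      (\<integral>\<^sup>+x. ennreal (f x) \<partial>\<mu>) \<le> ennreal \<kappa> * (\<integral>\<^sup>+x. ennreal (f x) * ennreal (\<Sum>j=1..n. near \<rho> L (x - b j)) \<partial>lborel)"
proof -
  obtain \<nu> \<gamma>' where sing: "has_singularity \<nu> \<rho>" and "0 < \<gamma>'"
    and weak: "\<forall>f :: real \<Rightarrow> real. continuous_on UNIV f \<longrightarrow> (\<forall>x. 0 \<le> f x) \<longrightarrow>
      (\<integral>\<^sup>+x. ennreal (f x) \<partial>\<mu>) \<le> ennreal \<gamma>' * (\<integral>\<^sup>+x. ennreal (f x) \<partial>\<nu>)"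
    using assms unfolding has_weak_singularity_def by (elim exE conjE) (rule that)
  obtain d \<gamma> n a b r F where [measurable]: "d \<in> borel_measurable borel" and d0: "\<forall>x. 0 \<le> d x"
    and \<nu>: "\<nu> = density lborel (\<lambda>x. ennreal (d x))" and "0 < \<gamma>" and "0 \<le> \<rho>" "\<rho> < 1"
    and b: "\<forall>j\<in>{1..n::nat}. b j \<in> {a j..<a (j + 1)} \<and> 0 \<le> r j \<and> r j \<le> \<rho>"
    and d: "\<forall>x. d x = (\<Sum>j=1..n. F j x)"
    and F: "\<forall>j\<in>{1..n}. \<forall>x. ereal (F j x) \<le>
              ereal \<gamma> * (indicator {a j..<a (j + 1)} x / ereal (abs_pow (x - b j) (r j)))"
    using sing unfolding has_singularity_def by (elim exE conjE) (rule that)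
  note weak = weak[rule_format] and d0 = d0[rule_format] and b = b[rule_format]
    and d = d[rule_format] and F = F[rule_format]
  \<comment> \<open>At least the length of each interval, so
    \<open>\<bar>x - b j\<bar> \<le> L\<close> on the \<open>j\<close>-th one, and at least 1, so
    powers of \<open>L\<close> increase with the exponent.\<close>
  define L where "L = 1 + (\<Sum>j=1..n. \<bar>a (j + 1) - a j\<bar>)"
  have "1 \<le> L" by (simp add: L_def sum_nonneg)
  have F_le: "F j x \<le> \<gamma> * L * near \<rho> L (x - b j)" if j: "j \<in> {1..n}" and x: "x \<noteq> b j" for j x
  proof -
    define y where "y = x - b j"
    have "y \<noteq> 0" using x by (simp add: y_def)
    then have pow: "abs_pow y (r j) = \<bar>y\<bar> powr r j" "0 < \<bar>y\<bar> powr r j"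
      by (auto simp: abs_pow_def)
    have "ereal (F j x) \<le> ereal (\<gamma> * (indicator {a j..<a (j + 1)} x / \<bar>y\<bar> powr r j))"
      using F[OF j, of x] pow by (auto simp: indicator_def one_ereal_def simp flip: y_def)
    then have F': "F j x \<le> \<gamma> * (indicator {a j..<a (j + 1)} x / \<bar>y\<bar> powr r j)"
      by simp
    show ?thesis
    proof (cases "x \<in> {a j..<a (j + 1)}")
      case True
      have "\<bar>a (j + 1) - a j\<bar> \<le> (\<Sum>j=1..n. \<bar>a (j + 1) - a j\<bar>)"
        by (rule member_le_sum) (use j in auto)
      then have y_le: "\<bar>y\<bar> \<le> L"
        using True b[OF j] by (auto simp: y_def L_def)
      \<comment> \<open>The excess exponent \<open>\<rho> - r j\<close> lies in
        \<open>[0, 1)\<close>, so the first factor is at most \<open>L\<close>.\<close>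
      have "1 / \<bar>y\<bar> powr r j = \<bar>y\<bar> powr (\<rho> - r j) * \<bar>y\<bar> powr -\<rho>"
        using \<open>y \<noteq> 0\<close> by (simp add: powr_diff powr_minus_divide)
      also have "\<dots> \<le> L powr 1 * \<bar>y\<bar> powr -\<rho>"
      proof (intro mult_right_mono)
        have "\<bar>y\<bar> powr (\<rho> - r j) \<le> L powr (\<rho> - r j)"
          using b[OF j] y_le by (intro powr_mono2) auto
        also have "\<dots> \<le> L powr 1"
          using b[OF j] \<open>\<rho> < 1\<close> \<open>1 \<le> L\<close> by (intro powr_mono) auto
        finally show "\<bar>y\<bar> powr (\<rho> - r j) \<le> L powr 1" .
      qed auto
      finally have "\<gamma> * (1 / \<bar>y\<bar> powr r j) \<le> \<gamma> * (L powr 1 * \<bar>y\<bar> powr -\<rho>)"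
        using \<open>0 < \<gamma>\<close> by (intro mult_left_mono) auto
      then show ?thesis
        using F' True y_le \<open>1 \<le> L\<close> by (simp add: near_def mult.assoc flip: y_def)
    next
      case False
      \<comment> \<open>Off its interval \<open>F j\<close> is bounded above by 0 but may be
        negative.\<close>
      then have "F j x \<le> 0" using F' by simp
      also have "0 \<le> \<gamma> * L * near \<rho> L (x - b j)"
        using \<open>0 < \<gamma>\<close> \<open>1 \<le> L\<close> by simp
      finally show ?thesis .
    qed
  qed
  have d_le: "d x \<le> \<gamma> * L * (\<Sum>j=1..n. near \<rho> L (x - b j))" if "x \<notin> b ` {1..n}" for x
    unfolding d sum_distrib_left by (intro sum_mono F_le) (use that in auto)
  \<comment> \<open>At a centre \<open>b j\<close> its own translate of \<open>near\<close> is 0,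
    whereas \<open>d\<close> may be positive there.\<close>
  have ae: "AE x in lborel. x \<notin> b ` {1..n}"
    by (intro AE_not_in finite_imp_null_set_lborel) simp
  show thesis
  proof (rule that[of L "\<gamma>' * (\<gamma> * L)"])
    show "1 \<le> L" "0 < \<gamma>' * (\<gamma> * L)"
      using \<open>1 \<le> L\<close> \<open>0 < \<gamma>'\<close> \<open>0 < \<gamma>\<close> by auto
  next
    show "\<forall>f :: real \<Rightarrow> real. continuous_on UNIV f \<longrightarrow> (\<forall>x. 0 \<le> f x) \<longrightarrow>
      (\<integral>\<^sup>+x. ennreal (f x) \<partial>\<mu>) \<le> ennreal (\<gamma>' * (\<gamma> * L)) *
        (\<integral>\<^sup>+x. ennreal (f x) * ennreal (\<Sum>j=1..n. near \<rho> L (x - b j)) \<partial>lborel)"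
    proof (intro allI impI)
      fix f :: "real \<Rightarrow> real"
      assume f0: "continuous_on UNIV f" "\<forall>x. 0 \<le> f x"
      note f = f0(1) f0(2)[rule_format]
      have [measurable]: "f \<in> borel_measurable borel"
        by (rule borel_measurable_continuous_onI[OF f(1)])
      have "(\<integral>\<^sup>+x. ennreal (f x) \<partial>\<nu>) = (\<integral>\<^sup>+x. ennreal (d x) * ennreal (f x) \<partial>lborel)"
        unfolding \<nu> by (rule nn_integral_density) measurable
      also have "\<dots> \<le> (\<integral>\<^sup>+x. ennreal (\<gamma> * L) * (ennreal (f x) * ennreal (\<Sum>j=1..n. near \<rho> L (x - b j))) \<partial>lborel)"
      proof (rule nn_integral_mono_AE, use ae in eventually_elim)
        fix x assume "x \<notin> b ` {1..n}"
        then have "d x * f x \<le> \<gamma> * L * (\<Sum>j=1..n. near \<rho> L (x - b j)) * f x"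
          by (intro mult_right_mono d_le f)
        then have "ennreal (d x * f x) \<le> ennreal (\<gamma> * L * (f x * (\<Sum>j=1..n. near \<rho> L (x - b j))))"
          by (intro ennreal_leI) (simp add: mult_ac)
        then show "ennreal (d x) * ennreal (f x)
            \<le> ennreal (\<gamma> * L) * (ennreal (f x) * ennreal (\<Sum>j=1..n. near \<rho> L (x - b j)))"
          using d0 f \<open>0 < \<gamma>\<close> \<open>1 \<le> L\<close> by (simp add: sum_nonneg flip: ennreal_mult)
      qed
      also have "\<dots> = ennreal (\<gamma> * L) * (\<integral>\<^sup>+x. ennreal (f x) * ennreal (\<Sum>j=1..n. near \<rho> L (x - b j)) \<partial>lborel)"
        by (rule nn_integral_cmult) measurable
      finally have "ennreal \<gamma>' * (\<integral>\<^sup>+x. ennreal (f x) \<partial>\<nu>)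
          \<le> ennreal \<gamma>' * (ennreal (\<gamma> * L) * (\<integral>\<^sup>+x. ennreal (f x) * ennreal (\<Sum>j=1..n. near \<rho> L (x - b j)) \<partial>lborel))"
        by (rule mult_left_mono) simp
      also have "\<dots> = ennreal (\<gamma>' * (\<gamma> * L)) * (\<integral>\<^sup>+x. ennreal (f x) * ennreal (\<Sum>j=1..n. near \<rho> L (x - b j)) \<partial>lborel)"
        using \<open>0 < \<gamma>'\<close> \<open>0 < \<gamma>\<close> \<open>1 \<le> L\<close> by (simp add: ennreal_mult mult.assoc)
      finally show "(\<integral>\<^sup>+x. ennreal (f x) \<partial>\<mu>) \<le> \<dots>"
        using weak[OF f0(1)] f(2) by (meson order_trans)
    qed
  qed
qed

section \<open>Summation over the centres, with the cutoff still free\<close>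

lemma nn_integral_translate:
  fixes b :: real
  assumes [measurable]: "h \<in> borel_measurable borel"
  shows "(\<integral>\<^sup>+x. h (x - b) \<partial>lborel) = (\<integral>\<^sup>+x. h x \<partial>lborel)"
  by (subst (2) nn_integral_real_affine[where c = 1 and t = "- b"]) auto

text \<open>One factor \<open>n\<close> comes from Cauchy-Schwarz, the other from adding
  \<open>n\<close> equal integrals.\<close>

lemma nn_integral_sum_squared_translates_le:
  fixes h :: "real \<Rightarrow> real"
  assumes [measurable]: "h \<in> borel_measurable borel"
  shows "(\<integral>\<^sup>+x. ennreal ((\<Sum>j=1..n. h (x - b j))\<^sup>2) \<partial>lborel) \<le> of_nat (n\<^sup>2) * (\<integral>\<^sup>+x. ennreal ((h x)\<^sup>2) \<partial>lborel)"
proof -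
  have "(\<integral>\<^sup>+x. ennreal ((\<Sum>j=1..n. h (x - b j))\<^sup>2) \<partial>lborel)
      \<le> (\<integral>\<^sup>+x. (\<Sum>j=1..n. ennreal ((h (x - b j))\<^sup>2)) * of_nat n \<partial>lborel)"
  proof (rule nn_integral_mono)
    fix x
    have "ennreal ((\<Sum>j=1..n. h (x - b j))\<^sup>2) \<le> ennreal ((\<Sum>j=1..n. (h (x - b j))\<^sup>2) * of_nat n)"
      using sum_squared_le_sum_of_squares[of "\<lambda>j. h (x - b j)" "{1..n}"] by (intro ennreal_leI) simp
    also have "\<dots> = (\<Sum>j=1..n. ennreal ((h (x - b j))\<^sup>2)) * of_nat n"
      by (subst ennreal_mult) (auto simp: sum_nonneg ennreal_of_nat_eq_real_of_nat)
    finally show "ennreal ((\<Sum>j=1..n. h (x - b j))\<^sup>2) \<le> \<dots>" .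
  qed
  also have "\<dots> = (\<Sum>j=1..n. \<integral>\<^sup>+x. ennreal ((h (x - b j))\<^sup>2) \<partial>lborel) * of_nat n"
    by (simp add: nn_integral_multc nn_integral_sum del: sum_ennreal)
  also have "\<dots> = (\<Sum>j=1..n. \<integral>\<^sup>+x. ennreal ((h x)\<^sup>2) \<partial>lborel) * of_nat n"
    by (subst nn_integral_translate[where h = "\<lambda>x. ennreal ((h x)\<^sup>2)"]) auto
  also have "\<dots> = of_nat (n\<^sup>2) * (\<integral>\<^sup>+x. ennreal ((h x)\<^sup>2) \<partial>lborel)"
    by (simp add: power2_eq_square mult_ac)
  finally show ?thesis .
qed

text \<open>Joins the Gaussian mean, domination and the energy estimate. \<open>K\<close> and
  \<open>L\<close> are fixed before \<open>t\<close>, \<open>\<delta>\<close> and \<open>m\<close>,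
  so the cutoff may depend on \<open>t\<close>.\<close>

lemma mean_norm_fourier_transform_squared_split:
  assumes "finite_borel_measure \<mu>" "has_weak_singularity \<mu> \<rho>"
  obtains K L :: real where "0 < K" "1 \<le> L"
    "\<And>t \<delta> m. \<lbrakk>0 < t; \<And>y. ennreal (far \<rho> \<delta> L y) \<le> m\<rbrakk> \<Longrightarrow>
      ennreal (1 / t * (LBINT s:{0..t}. (cmod (fourier_transform \<mu> s))\<^sup>2))
      \<le> ennreal K * (ennreal (1 / t) * ((\<integral>\<^sup>+y. ennreal ((far \<rho> \<delta> L y)\<^sup>2) \<partial>lborel)
           + 2 * m * (\<integral>\<^sup>+y. near \<rho> \<delta> y \<partial>lborel)) + (\<integral>\<^sup>+y. near \<rho> \<delta> y \<partial>lborel)\<^sup>2)"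
proof -
  interpret finite_borel_measure \<mu> by fact
  obtain n b L \<kappa> where "1 \<le> L" "0 < \<kappa>" and dom: "\<forall>f :: real \<Rightarrow> real. continuous_on UNIV f \<longrightarrow> (\<forall>x. 0 \<le> f x) \<longrightarrow>
      (\<integral>\<^sup>+x. ennreal (f x) \<partial>\<mu>) \<le> ennreal \<kappa> * (\<integral>\<^sup>+x. ennreal (f x) * ennreal (\<Sum>j=1..(n::nat). near \<rho> L (x - b j)) \<partial>lborel)"
    by (rule has_weak_singularity_dominated[OF assms(2)])
  define D where "D = sqrt (2 * pi) * exp (1 / 2 :: real)"
  \<comment> \<open>The summand 1 keeps \<open>K\<close> positive when \<open>n = 0\<close>.\<close>
  define K where "K = D * (\<kappa>\<^sup>2 * real (n\<^sup>2)) + 1"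
  have "0 \<le> D" by (simp add: D_def)
  show thesis
  proof (rule that[of K L])
    show "0 < K" using \<open>0 \<le> D\<close> by (simp add: K_def add_nonneg_pos)
    show "1 \<le> L" by fact
    fix t \<delta> :: real and m :: ennreal
    assume "0 < t" and m: "\<And>y. ennreal (far \<rho> \<delta> L y) \<le> m"
    let ?F = "\<integral>\<^sup>+y. ennreal ((far \<rho> \<delta> L y)\<^sup>2) \<partial>lborel" and ?N = "\<integral>\<^sup>+y. ennreal (near \<rho> \<delta> y) \<partial>lborel"
    define u where "u x = (\<Sum>j=1..n. far \<rho> \<delta> L (x - b j))" for x
    define v where "v x = (\<Sum>j=1..n. near \<rho> \<delta> (x - b j))" for x
    have [measurable]: "u \<in> borel_measurable borel" "v \<in> borel_measurable borel"
      unfolding u_def v_def by measurable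
    have nonneg: "0 \<le> u x" "0 \<le> v x" for x
      by (auto simp: u_def v_def intro: sum_nonneg)
    have m': "ennreal (u x) \<le> of_nat n * m" for x
      using sum_mono[of "{1..n}" "\<lambda>j. ennreal (far \<rho> \<delta> L (x - b j))" "\<lambda>_. m"] m
      by (simp add: u_def)
    have F: "(\<integral>\<^sup>+x. ennreal ((u x)\<^sup>2) \<partial>lborel) \<le> of_nat (n\<^sup>2) * ?F"
      unfolding u_def by (rule nn_integral_sum_squared_translates_le) measurable
    have N: "(\<integral>\<^sup>+x. v x \<partial>lborel) = of_nat n * ?N"
      by (simp add: v_def nn_integral_sum nn_integral_translate[where h = "\<lambda>x. ennreal (near \<rho> \<delta> x)"]
          flip: sum_ennreal)
    have c: "0 < 2 * pi * t" using \<open>0 < t\<close> by simp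
    have "sqrt (2 * pi) \<le> 2 * pi"
      using pi_ge_two by (intro real_le_lsqrt) (auto simp: power2_eq_square)
    then have A: "ennreal (sqrt (2 * pi) / (2 * pi * t)) \<le> ennreal (1 / t)"
      using \<open>0 < t\<close> by (intro ennreal_leI) (simp add: field_simps)
    \<comment> \<open>All three energy terms are quadratic in the density, so passing to
      \<open>n\<close> translates costs the common factor \<open>n\<^sup>2\<close>.\<close>
    have scale: "a * (k\<^sup>2 * f + 2 * (k * m) * (k * h)) + (k * h)\<^sup>2 = k\<^sup>2 * (a * (f + 2 * m * h) + h\<^sup>2)"
      for a k f h :: ennreal
      by (simp add: power2_eq_square distrib_left mult_ac)
    let ?g = "\<lambda>x y. ennreal (gauss (2 * pi * t) (x - y))"
    have "(\<integral>\<^sup>+x. \<integral>\<^sup>+y. ?g x y \<partial>\<mu> \<partial>\<mu>) \<le> (ennreal \<kappa>)\<^sup>2 * (\<integral>\<^sup>+x. \<integral>\<^sup>+y. ?g x y *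
        (ennreal (\<Sum>j=1..n. near \<rho> L (x - b j)) * ennreal (\<Sum>j=1..n. near \<rho> L (y - b j))) \<partial>lborel \<partial>lborel)"
      by (rule gauss_energy_le_of_dominated[OF _ dom[rule_format]]) auto
    also have "\<dots> \<le> (ennreal \<kappa>)\<^sup>2 * (\<integral>\<^sup>+x. \<integral>\<^sup>+y. ?g x y *
        (ennreal (u x + v x) * ennreal (u y + v y)) \<partial>lborel \<partial>lborel)"
      unfolding u_def v_def sum.distrib[symmetric]
      by (intro mult_left_mono nn_integral_mono mult_mono ennreal_leI sum_mono near_le_near_add_far) auto
    also have "\<dots> \<le> (ennreal \<kappa>)\<^sup>2 * (ennreal (sqrt (2 * pi) / (2 * pi * t)) * ((\<integral>\<^sup>+x. ennreal ((u x)\<^sup>2) \<partial>lborel)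
        + 2 * (of_nat n * m) * (\<integral>\<^sup>+x. v x \<partial>lborel)) + (\<integral>\<^sup>+x. v x \<partial>lborel)\<^sup>2)"
      by (intro mult_left_mono gauss_energy_le c nonneg m') auto
    also have "\<dots> \<le> (ennreal \<kappa>)\<^sup>2 * (ennreal (1 / t) * (of_nat (n\<^sup>2) * ?F
        + 2 * (of_nat n * m) * (of_nat n * ?N)) + (of_nat n * ?N)\<^sup>2)"
      unfolding N by (intro mult_left_mono add_mono mult_mono A F order_refl) auto
    also have "ennreal (1 / t) * (of_nat (n\<^sup>2) * ?F + 2 * (of_nat n * m) * (of_nat n * ?N)) + (of_nat n * ?N)\<^sup>2
        = of_nat (n\<^sup>2) * (ennreal (1 / t) * (?F + 2 * m * ?N) + ?N\<^sup>2)"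
      unfolding of_nat_power by (rule scale)
    also have "(ennreal \<kappa>)\<^sup>2 * (of_nat (n\<^sup>2) * (ennreal (1 / t) * (?F + 2 * m * ?N) + ?N\<^sup>2))
        = ennreal (\<kappa>\<^sup>2 * real (n\<^sup>2)) * (ennreal (1 / t) * (?F + 2 * m * ?N) + ?N\<^sup>2)"
      using \<open>0 < \<kappa>\<close> by (simp only: ennreal_mult zero_le_power2 of_nat_0_le_iff ennreal_power less_imp_le
          mult.assoc flip: ennreal_of_nat_eq_real_of_nat)
    finally have "ennreal D * (\<integral>\<^sup>+x. \<integral>\<^sup>+y. ?g x y \<partial>\<mu> \<partial>\<mu>)
        \<le> ennreal D * (ennreal (\<kappa>\<^sup>2 * real (n\<^sup>2)) * (ennreal (1 / t) * (?F + 2 * m * ?N) + ?N\<^sup>2))"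
      by (rule mult_left_mono) simp
    also have "\<dots> = ennreal (D * (\<kappa>\<^sup>2 * real (n\<^sup>2))) * (ennreal (1 / t) * (?F + 2 * m * ?N) + ?N\<^sup>2)"
      using \<open>0 \<le> D\<close> by (simp add: ennreal_mult mult.assoc)
    also have "\<dots> \<le> ennreal K * (ennreal (1 / t) * (?F + 2 * m * ?N) + ?N\<^sup>2)"
      by (intro mult_right_mono ennreal_leI) (auto simp: K_def)
    finally show "ennreal (1 / t * (LBINT s:{0..t}. (cmod (fourier_transform \<mu> s))\<^sup>2)) \<le> \<dots>"
      using mean_norm_fourier_transform_squared_le[OF \<open>0 < t\<close>] unfolding D_def by order
  qed
qed

lemma ennreal_le_real_mult:
  assumes "ennreal a \<le> ennreal K * x" "x \<le> ennreal y" "0 \<le> K" "0 \<le> y"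
  shows "a \<le> K * y"
proof -
  have "ennreal a \<le> ennreal K * ennreal y"
    using assms(1) mult_left_mono[OF assms(2), of "ennreal K"] by auto
  then show ?thesis
    using assms(3,4) by (simp flip: ennreal_mult)
qed

section \<open>The cutoff at distance \<open>1 / t\<close>\<close>

text \<open>For \<open>\<delta> = 1 / t\<close> the far part is at most \<open>t powr \<rho>\<close>
  and the near part has integral of order at most \<open>t powr (\<rho> - 1)\<close>. The cross and
  near-near bounds are then both of order \<open>t powr (2 * \<rho> - 2)\<close>; only the far-far
  term \<open>F / t\<close> is left to the range of \<open>\<rho>\<close>.\<close>

lemma mean_norm_fourier_transform_squared_cutoff:
  assumes "finite_borel_measure \<mu>" "has_weak_singularity \<mu> \<rho>" "0 \<le> \<rho>" "\<rho> < 1"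
  obtains K L :: real where "0 < K" "1 \<le> L"
    "\<And>t F. \<lbrakk>0 < t; 0 \<le> F; (\<integral>\<^sup>+y. ennreal (y powr (- (2 * \<rho>))) * indicator {1 / t..L} y \<partial>lborel) \<le> ennreal F\<rbrakk> \<Longrightarrow>
      1 / t * (LBINT s:{0..t}. (cmod (fourier_transform \<mu> s))\<^sup>2)
      \<le> K * (F / t + 1 / t powr (2 * (1 - \<rho>)))"
proof -
  obtain K L :: real where "0 < K" "1 \<le> L" and bound:
    "\<And>t \<delta> m. \<lbrakk>0 < t; \<And>y. ennreal (far \<rho> \<delta> L y) \<le> m\<rbrakk> \<Longrightarrow>
      ennreal (1 / t * (LBINT s:{0..t}. (cmod (fourier_transform \<mu> s))\<^sup>2))
      \<le> ennreal K * (ennreal (1 / t) * ((\<integral>\<^sup>+y. ennreal ((far \<rho> \<delta> L y)\<^sup>2) \<partial>lborel)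
           + 2 * m * (\<integral>\<^sup>+y. near \<rho> \<delta> y \<partial>lborel)) + (\<integral>\<^sup>+y. near \<rho> \<delta> y \<partial>lborel)\<^sup>2)"
    using mean_norm_fourier_transform_squared_split[OF assms(1,2)] by blast
  define c where "c = 2 / (1 - \<rho>)"
  have "0 < c" using \<open>\<rho> < 1\<close> by (simp add: c_def)
  \<comment> \<open>The summands come from the two half-lines in the far-far term, the cross term
    and the squared near integral.\<close>
  define C where "C = 2 + 2 * c + c\<^sup>2"
  have "0 < C" using \<open>0 < c\<close> by (simp add: C_def add_pos_pos)
  show thesis
  proof (rule that[of "K * C" L])
    show "0 < K * C" "1 \<le> L" using \<open>0 < C\<close> \<open>0 < K\<close> \<open>1 \<le> L\<close> by auto
    fix t F :: real
    assume t: "0 < t" and "0 \<le> F"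
      and F: "(\<integral>\<^sup>+y. ennreal (y powr (- (2 * \<rho>))) * indicator {1 / t..L} y \<partial>lborel) \<le> ennreal F"
    define p where "p = 1 / t powr (2 * (1 - \<rho>))"
    have "0 < p" using t by (simp add: p_def)
    have p: "t powr (\<rho> - 1) * t powr (\<rho> - 1) = p" "1 / t * (t powr \<rho> * t powr (\<rho> - 1)) = p"
    proof -
      have "p = t powr (2 * \<rho> - 2)"
        using t by (simp add: p_def flip: powr_minus_divide)
      moreover have "t powr (2 * \<rho> - 2) = t powr (\<rho> - 1) * t powr (\<rho> - 1)"
        by (simp flip: powr_add)
      moreover have "t powr (\<rho> - 1) = t powr \<rho> * (1 / t)"
        using t by (simp add: powr_diff)
      ultimately show "t powr (\<rho> - 1) * t powr (\<rho> - 1) = p" "1 / t * (t powr \<rho> * t powr (\<rho> - 1)) = p"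
        by (simp_all add: mult_ac)
    qed
    have N: "(\<integral>\<^sup>+y. near \<rho> (1 / t) y \<partial>lborel) \<le> ennreal (c * t powr (\<rho> - 1))"
      using nn_integral_near_le[of \<rho> "1 / t"] t \<open>\<rho> < 1\<close>
      by (simp add: c_def powr_divide powr_diff field_simps)
    have F': "(\<integral>\<^sup>+y. ennreal ((far \<rho> (1 / t) L y)\<^sup>2) \<partial>lborel) \<le> ennreal (2 * F)"
      using nn_integral_far_squared_le[of "1 / t" \<rho> L] mult_left_mono[OF F, of 2] t
      by (simp add: ennreal_mult')
    \<comment> \<open>As \<open>\<rho> \<ge> 0\<close>, the power decreases in the distance and is
      largest at the cut.\<close>
    have far_le: "ennreal (far \<rho> (1 / t) L y) \<le> ennreal (t powr \<rho>)" for y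
    proof (cases "1 / t < \<bar>y\<bar>")
      case True
      then have "\<bar>y\<bar> powr -\<rho> \<le> (1 / t) powr -\<rho>"
        using t \<open>0 \<le> \<rho>\<close> by (intro powr_mono2') auto
      also have "\<dots> = t powr \<rho>"
        using t by (simp add: powr_divide powr_minus field_simps)
      finally show ?thesis by (intro ennreal_leI) (simp add: far_def)
    qed (simp add: far_def)
    have "ennreal (1 / t) * ((\<integral>\<^sup>+y. ennreal ((far \<rho> (1 / t) L y)\<^sup>2) \<partial>lborel)
           + 2 * ennreal (t powr \<rho>) * (\<integral>\<^sup>+y. near \<rho> (1 / t) y \<partial>lborel)) + (\<integral>\<^sup>+y. near \<rho> (1 / t) y \<partial>lborel)\<^sup>2
      \<le> ennreal (1 / t) * (ennreal (2 * F) + ennreal 2 * ennreal (t powr \<rho>) * ennreal (c * t powr (\<rho> - 1)))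
        + (ennreal (c * t powr (\<rho> - 1)))\<^sup>2"
      by (intro add_mono mult_mono power_mono N F') auto
    also have "\<dots> = ennreal (1 / t * (2 * F + 2 * t powr \<rho> * (c * t powr (\<rho> - 1))) + (c * t powr (\<rho> - 1))\<^sup>2)"
      using t \<open>0 \<le> F\<close> \<open>0 < c\<close> by (simp add: ennreal_power flip: ennreal_mult ennreal_plus del: ennreal_numeral)
    also have "1 / t * (2 * F + 2 * t powr \<rho> * (c * t powr (\<rho> - 1))) + (c * t powr (\<rho> - 1))\<^sup>2
        = 2 * (F / t) + 2 * c * (1 / t * (t powr \<rho> * t powr (\<rho> - 1))) + c\<^sup>2 * (t powr (\<rho> - 1) * t powr (\<rho> - 1))"
      by (simp add: distrib_left power2_eq_square mult_ac)
    also have "\<dots> = 2 * (F / t) + (2 * c + c\<^sup>2) * p"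
      unfolding p by (simp add: distrib_right)
    finally have "1 / t * (LBINT s:{0..t}. (cmod (fourier_transform \<mu> s))\<^sup>2) \<le> K * (2 * (F / t) + (2 * c + c\<^sup>2) * p)"
      by (rule ennreal_le_real_mult[OF bound[OF t far_le]]) (use \<open>0 < K\<close> \<open>0 < c\<close> \<open>0 < p\<close> \<open>0 \<le> F\<close> t in auto)
    also have "\<dots> \<le> K * (C * (F / t) + C * p)"
      using \<open>0 < K\<close> \<open>0 < c\<close> \<open>0 < p\<close> \<open>0 \<le> F\<close> t
      by (intro mult_left_mono add_mono mult_right_mono) (auto simp: C_def)
    finally show "1 / t * (LBINT s:{0..t}. (cmod (fourier_transform \<mu> s))\<^sup>2)
        \<le> K * C * (F / t + 1 / t powr (2 * (1 - \<rho>)))"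
      by (simp add: p_def distrib_left mult.assoc)
  qed
qed

section \<open>The three ranges of the exponent\<close>

text \<open>As \<open>2 * \<rho> < 1\<close>, the far-far integral stays below a constant
  independent of \<open>t\<close> even for \<open>\<delta> = 0\<close>, and the decay is that of the
  mass of the kernel.\<close>

lemma mean_norm_fourier_transform_squared_le_below_half:
  assumes "finite_borel_measure \<mu>" "has_weak_singularity \<mu> \<rho>" "\<rho> < 1 / 2"
  shows "\<exists>C>0. \<forall>t>0. 1 / t * (LBINT s:{0..t}. (cmod (fourier_transform \<mu> s))\<^sup>2) \<le> C * (1 / t)"
proof -
  obtain K L :: real where "0 < K" "1 \<le> L" and bound:
    "\<And>t \<delta> m. \<lbrakk>0 < t; \<And>y. ennreal (far \<rho> \<delta> L y) \<le> m\<rbrakk> \<Longrightarrow>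
      ennreal (1 / t * (LBINT s:{0..t}. (cmod (fourier_transform \<mu> s))\<^sup>2))
      \<le> ennreal K * (ennreal (1 / t) * ((\<integral>\<^sup>+y. ennreal ((far \<rho> \<delta> L y)\<^sup>2) \<partial>lborel)
           + 2 * m * (\<integral>\<^sup>+y. near \<rho> \<delta> y \<partial>lborel)) + (\<integral>\<^sup>+y. near \<rho> \<delta> y \<partial>lborel)\<^sup>2)"
    using mean_norm_fourier_transform_squared_split[OF assms(1,2)] by blast
  define F where "F = L powr (- (2 * \<rho>) + 1) / (- (2 * \<rho>) + 1)"
  have "0 < F" using assms(3) \<open>1 \<le> L\<close> by (simp add: F_def)
  have "(\<integral>\<^sup>+y. ennreal (y powr (- (2 * \<rho>))) * indicator {0..L} y \<partial>lborel) = ennreal F"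
    unfolding F_def
    by (rule nn_integral_has_integral_lebesgue'[OF _ has_integral_powr_from_0]) (use assms(3) \<open>1 \<le> L\<close> in auto)
  then have far_le: "(\<integral>\<^sup>+y. ennreal ((far \<rho> 0 L y)\<^sup>2) \<partial>lborel) \<le> ennreal (2 * F)"
    using nn_integral_far_squared_le[of 0 \<rho> L] by (simp add: ennreal_mult')
  have near_0: "(\<integral>\<^sup>+y. near \<rho> 0 y \<partial>lborel) = 0"
    using nn_integral_near_le[of \<rho> 0] assms(3) by simp
  have "1 / t * (LBINT s:{0..t}. (cmod (fourier_transform \<mu> s))\<^sup>2) \<le> K * (1 / t * (2 * F))" if "0 < t" for t
  \<comment> \<open>No cutoff: the far part may be unbounded, but the cross term vanishes since \<open>\<top> * 0 = 0\<close>.\<close>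
  proof (rule ennreal_le_real_mult[OF bound[of t 0 \<top>]])
    have "ennreal (1 / t) * (\<integral>\<^sup>+y. ennreal ((far \<rho> 0 L y)\<^sup>2) \<partial>lborel) \<le> ennreal (1 / t) * ennreal (2 * F)"
      by (intro mult_left_mono far_le) simp
    also have "\<dots> = ennreal (1 / t * (2 * F))"
      using that \<open>0 < F\<close> by (intro ennreal_mult[symmetric]) auto
    finally show "ennreal (1 / t) * ((\<integral>\<^sup>+y. ennreal ((far \<rho> 0 L y)\<^sup>2) \<partial>lborel)
        + 2 * \<top> * (\<integral>\<^sup>+y. near \<rho> 0 y \<partial>lborel)) + (\<integral>\<^sup>+y. near \<rho> 0 y \<partial>lborel)\<^sup>2 \<le> ennreal (1 / t * (2 * F))"
      by (simp add: near_0)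
  qed (use that \<open>0 < K\<close> \<open>0 < F\<close> in auto)
  then show ?thesis
    using \<open>0 < K\<close> \<open>0 < F\<close> by (intro exI[of _ "K * (2 * F)"]) (auto simp: mult_ac)
qed

text \<open>Here the far-far integral is that of \<open>1 / y\<close> over
  \<open>[1 / t, L]\<close>, namely \<open>ln L + ln t\<close>, while the other terms contribute
  \<open>1 / t\<close>.\<close>

lemma mean_norm_fourier_transform_squared_le_half:
  assumes "finite_borel_measure \<mu>" "has_weak_singularity \<mu> (1 / 2)"
  shows "\<exists>C>0. \<forall>t>2. 1 / t * (LBINT s:{0..t}. (cmod (fourier_transform \<mu> s))\<^sup>2) \<le> C * (ln t / t)"
proof -
  obtain K L :: real where "0 < K" "1 \<le> L" and bound:
    "\<And>t F. \<lbrakk>0 < t; 0 \<le> F; (\<integral>\<^sup>+y. ennreal (y powr (- (2 * (1 / 2)))) * indicator {1 / t..L} y \<partial>lborel) \<le> ennreal F\<rbrakk> \<Longrightarrow>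
      1 / t * (LBINT s:{0..t}. (cmod (fourier_transform \<mu> s))\<^sup>2)
      \<le> K * (F / t + 1 / t powr (2 * (1 - 1 / 2)))"
    using mean_norm_fourier_transform_squared_cutoff[OF assms] by auto
  \<comment> \<open>Chosen so that \<open>ln L + 1 = q * ln 2 \<le> q * ln t\<close> for
    \<open>t > 2\<close>, which absorbs the constants into the logarithm.\<close>
  define q where "q = (ln L + 1) / ln 2"
  define c where "c = q + 1"
  have q: "q * ln 2 = ln L + 1" "0 \<le> q"
    using \<open>1 \<le> L\<close> by (auto simp: q_def)
  have "1 / t * (LBINT s:{0..t}. (cmod (fourier_transform \<mu> s))\<^sup>2) \<le> K * c * (ln t / t)" if "2 < t" for t
  proof -
    have "1 / t \<le> 1" using that by simp
    then have "1 / t \<le> L" using \<open>1 \<le> L\<close> by linarith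
    have "(\<integral>\<^sup>+y. ennreal (y powr (- (2 * (1 / 2)))) * indicator {1 / t..L} y \<partial>lborel) = ennreal (ln L - ln (1 / t))"
    proof (rule nn_integral_FTC_Icc)
      fix y assume y: "y \<in> {1 / t..L}"
      have "0 < 1 / t" using that by simp
      then have "0 < y" using y by (meson atLeastAtMost_iff less_le_trans)
      then show "(ln has_real_derivative y powr (- (2 * (1 / 2)))) (at y)"
        by (auto intro!: derivative_eq_intros simp: powr_minus_divide)
    qed (use \<open>1 / t \<le> L\<close> in auto)
    also have "ln L - ln (1 / t) = ln L + ln t"
      using that by (simp add: ln_div)
    finally have "1 / t * (LBINT s:{0..t}. (cmod (fourier_transform \<mu> s))\<^sup>2)
        \<le> K * ((ln L + ln t) / t + 1 / t powr (2 * (1 - 1 / 2)))"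
      using that \<open>1 \<le> L\<close> by (intro bound) auto
    also have "(ln L + ln t) / t + 1 / t powr (2 * (1 - 1 / 2)) = (ln L + 1 + ln t) / t"
      using that by (simp add: add_divide_distrib)
    also have "\<dots> \<le> c * ln t / t"
    proof (rule divide_right_mono)
      have "q * ln 2 \<le> q * ln t"
        using that q(2) by (intro mult_left_mono) auto
      then show "ln L + 1 + ln t \<le> c * ln t"
        by (simp add: c_def distrib_right q(1))
    qed (use that in auto)
    finally show ?thesis
      using \<open>0 < K\<close> by (simp add: mult.assoc)
  qed
  moreover have "0 < c"
    using q(2) by (simp add: c_def)
  ultimately show ?thesis
    using \<open>0 < K\<close> by (intro exI[of _ "K * c"]) auto
qed

text \<open>As \<open>2 * \<rho> > 1\<close>, the far-far integral is governed by its lower end and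
  is at most a multiple of \<open>t powr (2 * \<rho> - 1)\<close>. Divided by \<open>t\<close>, this
  has the same order as the other terms.\<close>

lemma mean_norm_fourier_transform_squared_le_above_half:
  assumes "finite_borel_measure \<mu>" "has_weak_singularity \<mu> \<rho>" "1 / 2 < \<rho>" "\<rho> < 1"
  shows "\<exists>C>0. \<forall>t>0. 1 / t * (LBINT s:{0..t}. (cmod (fourier_transform \<mu> s))\<^sup>2)
    \<le> C * (1 / t powr (2 * (1 - \<rho>)))"
proof -
  have "0 \<le> \<rho>" using assms(3) by simp
  obtain K L :: real where "0 < K" "1 \<le> L" and bound:
    "\<And>t F. \<lbrakk>0 < t; 0 \<le> F; (\<integral>\<^sup>+y. ennreal (y powr (- (2 * \<rho>))) * indicator {1 / t..L} y \<partial>lborel) \<le> ennreal F\<rbrakk> \<Longrightarrow>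
      1 / t * (LBINT s:{0..t}. (cmod (fourier_transform \<mu> s))\<^sup>2)
      \<le> K * (F / t + 1 / t powr (2 * (1 - \<rho>)))"
    using mean_norm_fourier_transform_squared_cutoff[OF assms(1,2) \<open>0 \<le> \<rho>\<close> assms(4)] by blast
  define c where "c = 1 / (2 * \<rho> - 1)"
  have "0 < c" using assms(3) by (simp add: c_def)
  have "1 / t * (LBINT s:{0..t}. (cmod (fourier_transform \<mu> s))\<^sup>2) \<le> K * (c + 1) * (1 / t powr (2 * (1 - \<rho>)))"
    if "0 < t" for t
  proof -
    let ?F = "c * t powr (2 * \<rho> - 1)"
    \<comment> \<open>Extending the range to infinity also covers small \<open>t\<close>, for which
      \<open>1 / t\<close> exceeds \<open>L\<close>.\<close>
    have "(\<integral>\<^sup>+y. ennreal (y powr (- (2 * \<rho>))) * indicator {1 / t..L} y \<partial>lborel)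
        \<le> (\<integral>\<^sup>+y. ennreal (y powr (- (2 * \<rho>))) * indicator {1 / t..} y \<partial>lborel)"
      by (intro nn_integral_mono mult_left_mono) (auto simp: indicator_def)
    also have "\<dots> = ennreal (- ((1 / t) powr (- (2 * \<rho>) + 1)) / (- (2 * \<rho>) + 1))"
      by (rule nn_integral_has_integral_lebesgue'[OF _ has_integral_powr_to_inf]) (use assms(3) that in auto)
    also have "- ((1 / t) powr (- (2 * \<rho>) + 1)) / (- (2 * \<rho>) + 1) = ?F"
    proof -
      have "(1 / t) powr (- (2 * \<rho>) + 1) = t powr (2 * \<rho> - 1)"
        using that by (simp add: powr_divide flip: powr_minus_divide)
      then show ?thesis
        using assms(3) by (simp add: c_def field_simps)
    qed
    finally have "1 / t * (LBINT s:{0..t}. (cmod (fourier_transform \<mu> s))\<^sup>2)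
        \<le> K * (?F / t + 1 / t powr (2 * (1 - \<rho>)))"
      using that \<open>0 < c\<close> by (intro bound) auto
    also have "?F / t = c * (1 / t powr (2 * (1 - \<rho>)))"
    proof -
      have "t powr (2 * \<rho> - 1) / t = t powr (2 * \<rho> - 1 - 1)"
        using powr_diff[of t "2 * \<rho> - 1" 1] that by simp
      also have "\<dots> = t powr - (2 * (1 - \<rho>))"
        by (simp add: algebra_simps)
      also have "\<dots> = 1 / t powr (2 * (1 - \<rho>))"
        by (rule powr_minus_divide)
      finally show ?thesis by (metis times_divide_eq_right)
    qed
    finally show ?thesis
      by (simp add: algebra_simps add_divide_distrib)
  qed
  then show ?thesis
    using \<open>0 < K\<close> \<open>0 < c\<close> by (intro exI[of _ "K * (c + 1)"]) auto
qed

theorem theorem2p6: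
  fixes \<mu> :: "real measure" and \<rho> :: real
  assumes "finite_borel_measure \<mu>"
    and "0 \<le> \<rho>" and "\<rho> < 1"
    and "has_weak_singularity \<mu> \<rho>"
  shows "\<exists>C>0.
    (\<rho> < 1/2 \<longrightarrow> (\<forall>t>0.
       (1/t) * (LBINT s:{0..t}. (cmod (fourier_transform \<mu> s))\<^sup>2)
         \<le> C * (1/t))) \<and>
    (\<rho> = 1/2 \<longrightarrow> (\<forall>t>2.
       (1/t) * (LBINT s:{0..t}. (cmod (fourier_transform \<mu> s))\<^sup>2)
         \<le> C * (ln t / t))) \<and>
    (1/2 < \<rho> \<longrightarrow> (\<forall>t>0.
       (1/t) * (LBINT s:{0..t}. (cmod (fourier_transform \<mu> s))\<^sup>2)
         \<le> C * (1 / t powr (2 * (1 - \<rho>)))))"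
proof -
  \<comment> \<open>The constant may depend on \<open>\<rho>\<close>, so in each case the other two
    implications are vacuous.\<close>
  consider "\<rho> < 1/2" | "\<rho> = 1/2" | "1/2 < \<rho>" by linarith
  then show ?thesis
  proof cases
    case 1
    then show ?thesis
      using mean_norm_fourier_transform_squared_le_below_half[OF assms(1,4) 1] by auto
  next
    case 2
    have "has_weak_singularity \<mu> (1 / 2)"
      using assms(4) unfolding 2 .
    then show ?thesis
      using mean_norm_fourier_transform_squared_le_half[OF assms(1)] 2 by auto
  next
    case 3
    then show ?thesis
      using mean_norm_fourier_transform_squared_le_above_half[OF assms(1,4) 3 assms(3)] by auto
  qed
qed

end
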